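(* For every integer $x\ge 0$, the \textsc{flag coloring} position on the path with $x$ edges (i.e. $x+1$ vertices), properly two-colored, has Sprague–Grundy value $\ast(x \bmod 3)$.
   Context: \textsc{flag coloring} is an impartial two-player game played on a simple graph whose vertices are colored. A move consists of choosing a vertex $v$, of color $c$ say, and a color $c'\neq c$ that is the color of some vertex adjacent to $v$; then $v$ and every vertex of the connected component of the subgraph induced by color-$c$ vertices that contains $v$ are recolored $c'$. Play is under the normal play convention: a player unable to move loses. Each position gets a Sprague–Grundy value (nimber) $\ast n$, where $n$ is the minimum non-negative integer not among the values of its options (positions with no options have value $0$); $\ast 0=0$. *)

theory Defs
  imports "Graph_Theory.Graph_Theory"
begin

section \<open>Sprague--Grundy values\<close>

definition mex :: "nat set \<Rightarrow> nat" where
  "mex A = (LEAST n. n \<notin> A)"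

text \<open>
  An impartial game is given by its move relation \<open>move\<close>, where \<open>move p q\<close> means that
  \<open>q\<close> is an option of \<open>p\<close>.  The proposition \<open>sg_value move p n\<close> says that \<open>p\<close> has value \<open>n\<close>.
  As the relation is defined inductively, it also entails that every play from \<open>p\<close> terminates.
\<close>

inductive sg_value :: "('p \<Rightarrow> 'p \<Rightarrow> bool) \<Rightarrow> 'p \<Rightarrow> nat \<Rightarrow> bool" for move where
  "(\<And>q. move p q \<Longrightarrow> sg_value move q (g q)) \<Longrightarrow> sg_value move p (mex (g ` {q. move p q}))"

lemma sg_value_unique:
  assumes "sg_value move p m" "sg_value move p n"
  shows "m = n"
  using assms
proof (induction arbitrary: n)
  case (1 p g)
  from 1(3) obtain h where h: "n = mex (h ` {q. move p q})"
    and hv: "\<And>q. move p q \<Longrightarrow> sg_value move q (h q)"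
    by (auto elim: sg_value.cases)
  have "g ` {q. move p q} = h ` {q. move p q}"
    using 1(2) hv by (intro image_cong) auto
  with h show ?case by simp
qed

section \<open>Flag coloring\<close>

text \<open>
  A simple graph is a symmetric loop-free digraph without parallel arcs (locale \<open>pair_graph\<close>).
  A position on \<open>G\<close> is a coloring of its vertices; colors assigned outside \<open>pverts G\<close> are
  irrelevant and are never changed by a move.  In a simple graph, reachability is connectedness.
\<close>

definition color_component :: "'a pair_pre_digraph \<Rightarrow> ('a \<Rightarrow> 'c) \<Rightarrow> 'a \<Rightarrow> 'a set" where
  "color_component G c v =
     {w. v \<rightarrow>\<^sup>*\<^bsub>with_proj G \<restriction> {u \<in> pverts G. c u = c v}\<^esub> w}"

definition flag_move :: "'a pair_pre_digraph \<Rightarrow> ('a \<Rightarrow> 'c) \<Rightarrow> ('a \<Rightarrow> 'c) \<Rightarrow> bool" where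
  "flag_move G c d \<longleftrightarrow>
     (\<exists>v \<in> pverts G. \<exists>k. k \<noteq> c v \<and> (\<exists>u. (v, u) \<in> parcs G \<and> c u = k) \<and>
        d = (\<lambda>w. if w \<in> color_component G c v then k else c w))"

definition proper_coloring :: "'a pair_pre_digraph \<Rightarrow> ('a \<Rightarrow> 'c) \<Rightarrow> bool" where
  "proper_coloring G c \<longleftrightarrow> (\<forall>(u, v) \<in> parcs G. c u \<noteq> c v)"

text \<open>At most two colors occur; on a single vertex only one of them can.\<close>

definition properly_two_colored :: "'a pair_pre_digraph \<Rightarrow> ('a \<Rightarrow> 'c) \<Rightarrow> bool" where
  "properly_two_colored G c \<longleftrightarrow> proper_coloring G c \<and> (\<exists>a b. c ` pverts G \<subseteq> {a, b})"

definition path_graph :: "nat \<Rightarrow> nat pair_pre_digraph" where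
  "path_graph x = \<lparr> pverts = {0..x},
     parcs = {(i, j). i \<le> x \<and> j \<le> x \<and> (j = Suc i \<or> i = Suc j)} \<rparr>"

lemma pair_graph_path_graph: "pair_graph (path_graph x)"
proof -
  have "finite (parcs (path_graph x))"
    by (rule finite_subset[of _ "{0..x} \<times> {0..x}"]) (auto simp: path_graph_def)
  then show ?thesis
    by unfold_locales
      (auto simp: path_graph_def symmetric_def arcs_ends_conv intro!: symI)
qed

end

theory Submission
  imports Defs
begin

text \<open>
  Contracting the monochromatic runs of a two-colored path leaves a properly two-colored path whose
  edges are the bichromatic edges.  Recoloring an end run destroys one of them and recoloring an
  inner run destroys two, so the game is the subtraction game in which one or two tokens are removed
  from a heap, whose values are the residues modulo 3.
\<close>

section \<open>Bichromatic edges and the subtraction game modulo 3\<close>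

text \<open>The edge between \<open>i\<close> and \<open>Suc i\<close> is encoded by its left end
  \<open>i\<close>, so \<open>x\<close> itself is never an index. The cardinality of this set is the
  heap size.\<close>

definition bichromatic_edges :: "nat \<Rightarrow> (nat \<Rightarrow> 'c) \<Rightarrow> nat set" where
  "bichromatic_edges x c = {i. i < x \<and> c i \<noteq> c (Suc i)}"

lemma finite_bichromatic_edges [simp]: "finite (bichromatic_edges x c)"
  by (simp add: bichromatic_edges_def)

lemma mexI:
  assumes "n \<notin> A" "\<And>m. m < n \<Longrightarrow> m \<in> A"
  shows "mex A = n"
  unfolding mex_def using assms by (intro Least_equality) (auto simp: not_less[symmetric])

text \<open>Neither 1 nor 2 is a multiple of 3. This is the half of the mex computation that
  excludes a heap's own residue from its options; the lower bounds on \<open>e\<close> guard against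
  truncated subtraction.\<close>

lemma subtraction_mod_3_neq:
  fixes e e' :: nat
  assumes "e \<ge> 1 \<and> e' = e - 1 \<or> e \<ge> 2 \<and> e' = e - 2"
  shows "e mod 3 \<noteq> e' mod 3"
proof -
  from assms have "e = Suc e' \<or> e = Suc (Suc e')" by auto
  then show ?thesis by (auto simp: mod_Suc split: if_splits)
qed

text \<open>Residue 1 needs only the value 0, obtained by removing one; residue 2 needs 1 and 0,
  obtained by removing one and two. Since \<open>e\<close> is at least its own residue, these
  removals are legal.\<close>

lemma subtraction_mod_3_hits:
  fixes e m :: nat
  assumes "m < e mod 3"
  shows "e \<ge> 1 \<and> m = (e - 1) mod 3 \<or> e \<ge> 2 \<and> m = (e - 2) mod 3"
proof (cases e rule: nat.exhaust)
  case (Suc n)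
  with assms show ?thesis by (cases n) (auto simp: mod_Suc split: if_splits)
qed (use assms in simp)

section \<open>Color components of a path are intervals\<close>

lemma arcs_ends_induced_path_graph:
  "arcs_ends (with_proj (path_graph x) \<restriction> S) = {(i, j) \<in> parcs (path_graph x). i \<in> S \<and> j \<in> S}"
  by (force simp: arcs_ends_def induce_subgraph_def arc_to_ends_def)

text \<open>The interval is taken maximal around \<open>v\<close>: extending it by one vertex at
  either end would contradict the choice of \<open>l\<close> or \<open>r\<close>, which gives the
  two boundary conditions.\<close>

lemma monochromatic_run:
  fixes c :: "nat \<Rightarrow> 'c"
  assumes "v \<le> x"
  obtains l r where "l \<le> v" "v \<le> r" "r \<le> x" "\<And>u. u \<in> {l..r} \<Longrightarrow> c u = c v"
    "l > 0 \<Longrightarrow> c (l - 1) \<noteq> c v" "r < x \<Longrightarrow> c (Suc r) \<noteq> c v"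
proof -
  define k where "k = c v"
  define P where "P l \<longleftrightarrow> l \<le> v \<and> (\<forall>u\<in>{l..v}. c u = k)" for l
  define Q where "Q r \<longleftrightarrow> v \<le> r \<and> r \<le> x \<and> (\<forall>u\<in>{v..r}. c u = k)" for r
  define l where "l = (LEAST l. P l)"
  define r where "r = (GREATEST r. Q r)"
  have "P v" "Q v" using assms by (auto simp: P_def Q_def k_def)
  have P: "P l" unfolding l_def using \<open>P v\<close> by (rule LeastI)
  \<comment> \<open>\<open>GREATEST\<close> on the naturals requires a bound; the last vertex
    \<open>x\<close> provides it.\<close>
  have Q: "Q r" unfolding r_def
    using \<open>Q v\<close> by (rule GreatestI_nat[where b = x]) (simp add: Q_def)
  have "c (l - 1) \<noteq> k" if "l > 0"
  proof
    assume "c (l - 1) = k"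
    have "c u = k" if "u \<in> {l - 1..v}" for u
      using that P \<open>c (l - 1) = k\<close> unfolding P_def by (cases "u = l - 1") auto
    then have "P (l - 1)" using P by (auto simp: P_def)
    then have "l \<le> l - 1" unfolding l_def by (rule Least_le)
    with that show False by simp
  qed
  moreover have "c (Suc r) \<noteq> k" if "r < x"
  proof
    assume "c (Suc r) = k"
    then have "Q (Suc r)" using Q that by (auto simp: Q_def le_Suc_eq)
    then have "Suc r \<le> r" unfolding r_def
      by (rule Greatest_le_nat[where b = x]) (simp add: Q_def)
    then show False by simp
  qed
  moreover have "c u = k" if "u \<in> {l..r}" for u
    using that P Q unfolding P_def Q_def by (cases "u \<le> v") auto
  ultimately show ?thesis
    using that P Q unfolding P_def Q_def k_def by blast
qed

text \<open>Walking outward from \<open>v\<close> along the run reaches all of it, and the two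
  vertices just outside have the wrong color, so no walk in the induced subgraph leaves it.\<close>

lemma color_component_path_graph:
  fixes c :: "nat \<Rightarrow> 'c"
  assumes lr: "l \<le> v" "v \<le> r" "r \<le> x"
    and run: "\<And>u. u \<in> {l..r} \<Longrightarrow> c u = c v"
    and left: "l > 0 \<Longrightarrow> c (l - 1) \<noteq> c v"
    and right: "r < x \<Longrightarrow> c (Suc r) \<noteq> c v"
  shows "color_component (path_graph x) c v = {l..r}"
proof -
  let ?S = "{u \<in> pverts (path_graph x). c u = c v}"
  let ?H = "with_proj (path_graph x) \<restriction> ?S"
  let ?R = "rtrancl_on (verts ?H) (arcs_ends ?H)"
  have verts: "verts ?H = ?S" by simp
  have S: "u \<in> ?S" if "u \<in> {l..r}" for u
    using that run[OF that] lr by (auto simp: path_graph_def)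
  have arc: "(i, j) \<in> arcs_ends ?H" if "i \<in> {l..r}" "j \<in> {l..r}" "j = Suc i \<or> i = Suc j" for i j
    using that S[OF that(1)] S[OF that(2)] lr
    unfolding arcs_ends_induced_path_graph by (auto simp: path_graph_def)
  have "(v, v) \<in> ?R"
    unfolding verts using lr by (intro rtrancl_on_refl S) simp
  have up: "w \<le> r \<Longrightarrow> (v, w) \<in> ?R" if "v \<le> w" for w
    using that
  proof (induction rule: dec_induct)
    case base
    show ?case by (rule \<open>(v, v) \<in> ?R\<close>)
  next
    case (step n)
    then have "(v, n) \<in> ?R" by simp
    moreover have "(n, Suc n) \<in> arcs_ends ?H" using step lr by (intro arc) auto
    moreover have "Suc n \<in> verts ?H" unfolding verts using step lr by (intro S) simp
    ultimately show ?case by (rule rtrancl_on_into_rtrancl_on)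
  qed
  have down: "l \<le> w \<Longrightarrow> (v, w) \<in> ?R" if "w \<le> v" for w
    using that
  proof (induction rule: inc_induct)
    case base
    show ?case by (rule \<open>(v, v) \<in> ?R\<close>)
  next
    case (step n)
    then have "(v, Suc n) \<in> ?R" by simp
    moreover have "(Suc n, n) \<in> arcs_ends ?H" using step lr by (intro arc) auto
    moreover have "n \<in> verts ?H" unfolding verts using step lr by (intro S) simp
    ultimately show ?case by (rule rtrancl_on_into_rtrancl_on)
  qed
  \<comment> \<open>Membership in the interval is an invariant of walks: a single arc could leave it
    only to \<open>Suc r\<close> or \<open>l - 1\<close>, both excluded by color.\<close>
  have stay: "w \<in> {l..r}" if "(v, w) \<in> ?R" for w
    using that
  proof (induction rule: rtrancl_on_induct)
    case base
    show ?case using lr by simp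
  next
    case (step i j)
    from step have ij: "i \<in> {l..r}" "j \<le> x" "c j = c v" "j = Suc i \<or> i = Suc j"
      unfolding arcs_ends_induced_path_graph by (auto simp: path_graph_def)
    show ?case
    proof (rule ccontr)
      assume "j \<notin> {l..r}"
      with ij have "(j = Suc r \<and> r < x) \<or> (l > 0 \<and> j = l - 1)" by auto
      with left right ij show False by auto
    qed
  qed
  have "(v, w) \<in> ?R \<longleftrightarrow> w \<in> {l..r}" for w
    using stay[of w] up[of w] down[of w] nat_le_linear[of v w] unfolding atLeastAtMost_iff
    by blast
  then show ?thesis unfolding color_component_def reachable_def by blast
qed

section \<open>Effect of a move on the bichromatic edges\<close>

text \<open>With only two colors, both neighbors of the run already have the new color, so the run
  merges with them and exactly its boundary edges disappear. The set \<open>{i. Suc i = l}\<close>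
  is \<open>{l - 1}\<close> for positive \<open>l\<close> and empty for \<open>l = 0\<close>; when
  \<open>r = x\<close>, deleting \<open>r\<close> removes no edge.\<close>

lemma bichromatic_edges_recolor:
  fixes c :: "nat \<Rightarrow> 'c"
  assumes colors: "c ` {0..x} \<subseteq> {a, b}" and v: "v \<le> x" and k: "k \<in> {a, b}" "k \<noteq> c v"
  obtains l r where "l \<le> v" "v \<le> r" "r \<le> x" "c ` {l..r} \<subseteq> {c v}"
    "l = 0 \<or> l - 1 \<in> bichromatic_edges x c" "r = x \<or> r \<in> bichromatic_edges x c"
    "bichromatic_edges x (\<lambda>w. if w \<in> color_component (path_graph x) c v then k else c w)
      = bichromatic_edges x c - ({i. Suc i = l} \<union> {r})"
proof -
  obtain l r where lr: "l \<le> v" "v \<le> r" "r \<le> x" and run: "\<And>u. u \<in> {l..r} \<Longrightarrow> c u = c v"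
    and left: "l > 0 \<Longrightarrow> c (l - 1) \<noteq> c v" and right: "r < x \<Longrightarrow> c (Suc r) \<noteq> c v"
    using monochromatic_run[OF v, of c] by metis
  let ?d = "\<lambda>w. if w \<in> {l..r} then k else c w"
  have other: "c u = k" if "u \<le> x" "c u \<noteq> c v" for u
  proof -
    have "c u \<in> {a, b}" "c v \<in> {a, b}" using colors that v by (auto simp: image_subset_iff)
    with that k show ?thesis by auto
  qed
  have ll: "c l = c v" and rr: "c r = c v" using run[of l] run[of r] lr by auto
  have "i \<in> bichromatic_edges x ?d \<longleftrightarrow> i \<in> bichromatic_edges x c - ({i. Suc i = l} \<union> {r})" for i
  proof (cases "i < x")
    case True
    \<comment> \<open>An edge either crosses the left or the right boundary of the run, or has both
      ends inside it, or both outside.\<close>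
    consider "Suc i = l" | "i = r" | "i \<in> {l..r}" "Suc i \<in> {l..r}" | "i \<notin> {l..r}" "Suc i \<notin> {l..r}"
      unfolding atLeastAtMost_iff by linarith
    then show ?thesis
    proof cases
      case 1
      then have "c i = k" using left lr by (intro other) auto
      with 1 lr show ?thesis by (auto simp: bichromatic_edges_def)
    next
      case 2
      then have "c (Suc i) = k" using right lr True by (intro other) auto
      with 2 lr show ?thesis by (auto simp: bichromatic_edges_def)
    next
      case 3
      with run[of i] run[of "Suc i"] show ?thesis by (auto simp: bichromatic_edges_def)
    next
      case 4
      with lr show ?thesis by (auto simp: bichromatic_edges_def)
    qed
  qed (auto simp: bichromatic_edges_def)
  then have "bichromatic_edges x ?d = bichromatic_edges x c - ({i. Suc i = l} \<union> {r})"
    by blast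
  moreover have "color_component (path_graph x) c v = {l..r}"
    using lr run left right by (rule color_component_path_graph)
  ultimately have D: "bichromatic_edges x
      (\<lambda>w. if w \<in> color_component (path_graph x) c v then k else c w)
      = bichromatic_edges x c - ({i. Suc i = l} \<union> {r})"
    by simp
  have l: "l = 0 \<or> l - 1 \<in> bichromatic_edges x c"
    using left lr ll by (auto simp: bichromatic_edges_def)
  have r: "r = x \<or> r \<in> bichromatic_edges x c"
    using right lr rr by (auto simp: bichromatic_edges_def)
  have "c ` {l..r} \<subseteq> {c v}" using run by blast
  from lr this l r D show ?thesis by (rule that)
qed

text \<open>The new color comes from a neighbor outside the run, so the run is not the whole path:
  it has one boundary edge if it touches an end of the path and two otherwise. The first conclusion
  keeps the two-color invariant for the later induction.\<close>

lemma flag_move_bichromatic_edges: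
  fixes c :: "nat \<Rightarrow> 'c"
  assumes colors: "c ` {0..x} \<subseteq> {a, b}" and "flag_move (path_graph x) c d"
  defines "e \<equiv> card (bichromatic_edges x c)"
  shows "d ` {0..x} \<subseteq> {a, b}"
    and "(e \<ge> 1 \<and> card (bichromatic_edges x d) = e - 1) \<or>
         (e \<ge> 2 \<and> card (bichromatic_edges x d) = e - 2)"
proof -
  from assms(2) obtain v k u where k: "k \<noteq> c v"
    and arc: "(v, u) \<in> parcs (path_graph x)" and cu: "c u = k"
    and d: "d = (\<lambda>w. if w \<in> color_component (path_graph x) c v then k else c w)"
    unfolding flag_move_def by blast
  from arc cu have v: "v \<le> x" and u: "u \<le> x" "c u = k" and vu: "u = Suc v \<or> v = Suc u"
    by (auto simp: path_graph_def)
  have kab: "k \<in> {a, b}" using colors u by (auto simp: image_subset_iff)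
  show "d ` {0..x} \<subseteq> {a, b}" using colors kab by (auto simp: d)
  obtain l r where lr: "l \<le> v" "v \<le> r" "r \<le> x" and run: "c ` {l..r} \<subseteq> {c v}"
    and l: "l = 0 \<or> l - 1 \<in> bichromatic_edges x c"
    and r: "r = x \<or> r \<in> bichromatic_edges x c"
    and D: "bichromatic_edges x d = bichromatic_edges x c - ({i. Suc i = l} \<union> {r})"
    by (rule bichromatic_edges_recolor[OF colors v kab k, folded d])
  \<comment> \<open>A vertex of color \<open>k\<close> cannot lie in a run of color
    \<open>c v\<close>; being adjacent to \<open>v\<close>, it witnesses that the run stops short of
    one end of the path.\<close>
  have "u \<notin> {l..r}" using run k u by blast
  then have ends: "l > 0 \<or> r < x" using vu lr u by auto
  have xD: "x \<notin> bichromatic_edges x c" by (simp add: bichromatic_edges_def)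
  consider "l > 0" "r < x" | "l = 0" "r < x" | "l > 0" "r = x"
    using ends lr by force
  then show "(e \<ge> 1 \<and> card (bichromatic_edges x d) = e - 1) \<or>
         (e \<ge> 2 \<and> card (bichromatic_edges x d) = e - 2)"
  proof cases
    case 1
    then have sub: "{l - 1, r} \<subseteq> bichromatic_edges x c" and two: "card {l - 1, r} = 2"
      using l r lr by auto
    have "{i. Suc i = l} \<union> {r} = {l - 1, r}" using 1 by auto
    then have "card (bichromatic_edges x d) = e - 2"
      using sub two by (simp only: D e_def card_Diff_subset finite_insert finite.emptyI)
    moreover have "e \<ge> 2" using card_mono[OF _ sub] two by (simp add: e_def)
    ultimately show ?thesis by simp
  next
    case 2
    then have "card (bichromatic_edges x d) = e - 1" using r by (simp add: D e_def)
    moreover have "e \<ge> 1"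
      using r 2 card_gt_0_iff[of "bichromatic_edges x c"] by (auto simp: e_def Suc_le_eq)
    ultimately show ?thesis by simp
  next
    case 3
    then have "bichromatic_edges x d = bichromatic_edges x c - {l - 1}"
      using xD by (auto simp: D)
    then have "card (bichromatic_edges x d) = e - 1" using l 3 by (simp add: e_def)
    moreover have "e \<ge> 1"
      using l 3 card_gt_0_iff[of "bichromatic_edges x c"] by (auto simp: e_def Suc_le_eq)
    ultimately show ?thesis by simp
  qed
qed

section \<open>Moves that remove one or two bichromatic edges\<close>

text \<open>The move recolors the run of \<open>v\<close> with the color of \<open>Suc v\<close>.
  That run must end at \<open>v\<close>, so the edge \<open>v\<close> disappears, and
  \<open>l\<close> decides whether a second one does.\<close>

lemma flag_move_at_bichromatic_edge:
  fixes c :: "nat \<Rightarrow> 'c"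
  assumes colors: "c ` {0..x} \<subseteq> {a, b}" and v: "v \<in> bichromatic_edges x c"
  obtains d l where "flag_move (path_graph x) c d" "l \<le> v" "c ` {l..v} \<subseteq> {c v}"
    "l = 0 \<or> l - 1 \<in> bichromatic_edges x c"
    "bichromatic_edges x d = bichromatic_edges x c - ({i. Suc i = l} \<union> {v})"
proof -
  let ?k = "c (Suc v)"
  let ?d = "\<lambda>w. if w \<in> color_component (path_graph x) c v then ?k else c w"
  have vx: "v < x" and k: "?k \<noteq> c v" using v by (auto simp: bichromatic_edges_def)
  have kab: "?k \<in> {a, b}" using colors vx by (force simp: image_subset_iff)
  have move: "flag_move (path_graph x) c ?d"
    unfolding flag_move_def using vx k
    by (intro bexI[of _ v] exI[of _ ?k] conjI exI[of _ "Suc v"]) (auto simp: path_graph_def)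
  obtain l r where lr: "l \<le> v" "v \<le> r" "r \<le> x" and run: "c ` {l..r} \<subseteq> {c v}"
    and l: "l = 0 \<or> l - 1 \<in> bichromatic_edges x c"
    and "r = x \<or> r \<in> bichromatic_edges x c"
    and D: "bichromatic_edges x ?d = bichromatic_edges x c - ({i. Suc i = l} \<union> {r})"
    by (rule bichromatic_edges_recolor[OF colors less_imp_le[OF vx] kab k])
  have "Suc v \<notin> {l..r}" using run k by blast
  then have "r = v" using lr by simp
  show ?thesis
    using move lr(1) run l D unfolding \<open>r = v\<close> by (rule that)
qed

lemma flag_move_end_run:
  fixes c :: "nat \<Rightarrow> 'c"
  assumes colors: "c ` {0..x} \<subseteq> {a, b}" and "bichromatic_edges x c \<noteq> {}"
  obtains d where "flag_move (path_graph x) c d"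
    "card (bichromatic_edges x d) = card (bichromatic_edges x c) - 1"
proof -
  \<comment> \<open>At the leftmost bichromatic edge, the run to its left starts at vertex 0, so no
    second edge is lost.\<close>
  define v where "v = Min (bichromatic_edges x c)"
  have v: "v \<in> bichromatic_edges x c" unfolding v_def using assms by (intro Min_in) auto
  obtain d l where dl: "flag_move (path_graph x) c d" "l \<le> v"
    "c ` {l..v} \<subseteq> {c v}"
    "l = 0 \<or> l - 1 \<in> bichromatic_edges x c"
    "bichromatic_edges x d = bichromatic_edges x c - ({i. Suc i = l} \<union> {v})"
    by (rule flag_move_at_bichromatic_edge[OF colors v])
  have "l = 0"
  proof (rule ccontr)
    assume "l \<noteq> 0"
    then have "v \<le> l - 1" unfolding v_def using dl(4) by (intro Min_le) auto
    with dl(2) \<open>l \<noteq> 0\<close> show False by simp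
  qed
  with dl(5) v have "card (bichromatic_edges x d) = card (bichromatic_edges x c) - 1" by simp
  with dl(1) show ?thesis by (rule that)
qed

text \<open>Playing at an edge \<open>v\<close> with another bichromatic edge \<open>m\<close> to
  its left works: the run ending at \<open>v\<close> cannot extend back to 0 without containing both
  ends of \<open>m\<close>, so it has two boundary edges.\<close>

lemma flag_move_inner_run:
  fixes c :: "nat \<Rightarrow> 'c"
  assumes colors: "c ` {0..x} \<subseteq> {a, b}" and two: "card (bichromatic_edges x c) \<ge> 2"
  obtains d where "flag_move (path_graph x) c d"
    "card (bichromatic_edges x d) = card (bichromatic_edges x c) - 2"
proof -
  obtain m v where m: "m \<in> bichromatic_edges x c" and v: "v \<in> bichromatic_edges x c" and "m < v"
  proof -
    obtain i j where "i \<in> bichromatic_edges x c" "j \<in> bichromatic_edges x c" "i \<noteq> j"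
      using two by (auto simp: numeral_2_eq_2 card_le_Suc_iff)
    with that show thesis by (metis nat_neq_iff)
  qed
  obtain d l where dl: "flag_move (path_graph x) c d" "l \<le> v"
    "c ` {l..v} \<subseteq> {c v}"
    "l = 0 \<or> l - 1 \<in> bichromatic_edges x c"
    "bichromatic_edges x d = bichromatic_edges x c - ({i. Suc i = l} \<union> {v})"
    by (rule flag_move_at_bichromatic_edge[OF colors v])
  have "l \<noteq> 0"
  proof
    assume "l = 0"
    then have "m \<in> {l..v}" "Suc m \<in> {l..v}" using \<open>m < v\<close> by auto
    note this[THEN imageI, THEN subsetD[OF dl(3)]]
    with m show False by (simp add: bichromatic_edges_def)
  qed
  then have sub: "{l - 1, v} \<subseteq> bichromatic_edges x c" and card: "card {l - 1, v} = 2"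
    using dl(2,4) v by auto
  have "{i. Suc i = l} \<union> {v} = {l - 1, v}" using \<open>l \<noteq> 0\<close> by auto
  then have "card (bichromatic_edges x d) = card (bichromatic_edges x c) - 2"
    using sub card by (simp only: dl(5) card_Diff_subset finite_insert finite.emptyI)
  with dl(1) show ?thesis by (rule that)
qed

section \<open>Sprague-Grundy values\<close>

text \<open>Every move lowers the number of bichromatic edges, which allows strong induction on it.
  Properness is not preserved by moves in general, so the claim covers every coloring with at most
  two colors.\<close>

lemma sg_value_two_colored_path:
  fixes c :: "nat \<Rightarrow> 'c"
  assumes "c ` {0..x} \<subseteq> {a, b}"
  shows "sg_value (flag_move (path_graph x)) c (card (bichromatic_edges x c) mod 3)"
  using assms
proof (induction "card (bichromatic_edges x c)" arbitrary: c rule: less_induct)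
  case less
  let ?e = "card (bichromatic_edges x c)"
  \<comment> \<open>The function that \<open>sg_value.intros\<close> asks for; only its values on
    options matter, and there the induction hypothesis supplies them.\<close>
  let ?g = "\<lambda>d :: nat \<Rightarrow> 'c. card (bichromatic_edges x d) mod 3"
  let ?A = "?g ` {d. flag_move (path_graph x) c d}"
  note options = flag_move_bichromatic_edges[OF less.prems]
  have "sg_value (flag_move (path_graph x)) c (mex ?A)"
  proof (rule sg_value.intros)
    fix d assume "flag_move (path_graph x) c d"
    from options[OF this] show "sg_value (flag_move (path_graph x)) d (?g d)"
      by (intro less.hyps) auto
  qed
  moreover have "mex ?A = ?e mod 3"
  proof (rule mexI)
    show "?e mod 3 \<notin> ?A"
    proof
      assume "?e mod 3 \<in> ?A"
      then obtain d where d: "flag_move (path_graph x) c d" "?e mod 3 = ?g d" by auto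
      from subtraction_mod_3_neq[OF options(2)[OF d(1)]] d(2) show False by contradiction
    qed
  next
    fix m assume m: "m < ?e mod 3"
    have one: "(?e - 1) mod 3 \<in> ?A" if "?e \<ge> 1"
    proof -
      have "bichromatic_edges x c \<noteq> {}" using that by auto
      from flag_move_end_run[OF less.prems this] show ?thesis
        by (metis (mono_tags, lifting) image_eqI mem_Collect_eq)
    qed
    have two: "(?e - 2) mod 3 \<in> ?A" if "?e \<ge> 2"
      using flag_move_inner_run[OF less.prems that]
      by (metis (mono_tags, lifting) image_eqI mem_Collect_eq)
    from m have "?e \<ge> 1 \<and> m = (?e - 1) mod 3 \<or> ?e \<ge> 2 \<and> m = (?e - 2) mod 3"
      by (rule subtraction_mod_3_hits)
    with one two show "m \<in> ?A" by blast
  qed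
  ultimately show ?case by simp
qed

theorem theorem3:
  fixes x :: nat and c :: "nat \<Rightarrow> 'c"
  assumes "properly_two_colored (path_graph x) c"
  shows "sg_value (flag_move (path_graph x)) c (x mod 3)"
proof -
  from assms obtain a b where "c ` {0..x} \<subseteq> {a, b}"
    by (auto simp: properly_two_colored_def path_graph_def)
  \<comment> \<open>Properness makes all \<open>x\<close> edges bichromatic, so the heap has size
    \<open>x\<close>.\<close>
  moreover have "bichromatic_edges x c = {..<x}"
    using assms
    by (auto simp: properly_two_colored_def proper_coloring_def path_graph_def
        bichromatic_edges_def)
  ultimately show ?thesis using sg_value_two_colored_path[of c x a b] by simp
qed

end
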